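(* For every positive integer $n$, $$\frac{1}{\mathrm{Cat}_n^2}\sum_{\pi,\rho\in\mathrm{NC}(n)}d_H(\pi,\rho)\ge\frac{n-1}{2}.$$
   Context: For a positive integer $n$, a partition $\pi$ of $\{1,\ldots,n\}$ is non-crossing if there are no two distinct blocks $V,W$ of $\pi$ and numbers $a<b<c<d$ with $a,c\in V$ and $b,d\in W$. $\mathrm{NC}(n)$ is the set of non-crossing partitions of $\{1,\ldots,n\}$, partially ordered by $\pi\le\rho$ iff every block of $\pi$ is contained in a block of $\rho$. The Hasse diagram $\mathcal{H}_n$ is the undirected graph with vertex set $\mathrm{NC}(n)$ in which $\pi_1,\pi_2$ are joined by an edge iff one of them covers the other in $(\mathrm{NC}(n),\le)$; $d_H(\pi,\rho)$ is the graph distance in $\mathcal{H}_n$. $\mathrm{Cat}_n=\frac{(2n)!}{n!(n+1)!}=|\mathrm{NC}(n)|$ is the $n$th Catalan number. *)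

theory Defs
  imports "HOL-Library.Disjoint_Sets" "Graph_Theory.Graph_Theory"
begin

definition non_crossing :: "nat set set \<Rightarrow> bool" where
  "non_crossing P \<longleftrightarrow>
     \<not> (\<exists>V\<in>P. \<exists>W\<in>P. V \<noteq> W \<and>
          (\<exists>a b c d. a < b \<and> b < c \<and> c < d \<and> a \<in> V \<and> c \<in> V \<and> b \<in> W \<and> d \<in> W))"

definition NC :: "nat \<Rightarrow> nat set set set" where
  "NC n = {P. partition_on {1..n} P \<and> non_crossing P}"

text \<open>The order on \<open>NC n\<close> is \<^const>\<open>refines\<close>; covers are taken inside \<open>NC n\<close>, not in the
  lattice of all partitions.\<close>

definition NC_covers :: "nat \<Rightarrow> nat set set \<Rightarrow> nat set set \<Rightarrow> bool" where
  "NC_covers n P R \<longleftrightarrow>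
     P \<in> NC n \<and> R \<in> NC n \<and> P \<noteq> R \<and> refines {1..n} P R \<and>
     \<not> (\<exists>S\<in>NC n. S \<noteq> P \<and> S \<noteq> R \<and> refines {1..n} P S \<and> refines {1..n} S R)"

text \<open>An undirected edge is represented by its two opposite arcs.\<close>

definition hasse_NC :: "nat \<Rightarrow> nat set set pair_pre_digraph" where
  "hasse_NC n =
     \<lparr> pverts = NC n, parcs = {(P, R). NC_covers n P R \<or> NC_covers n R P} \<rparr>"

lemma finite_NC: "finite (NC n)"
proof (rule finite_subset)
  show "NC n \<subseteq> Pow (Pow {1..n})"
    by (auto simp: NC_def partition_on_def)
qed simp

lemma pair_graph_hasse_NC: "pair_graph (hasse_NC n)"
proof
  show "finite (parcs (hasse_NC n))"
    by (rule finite_subset[of _ "NC n \<times> NC n"])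
      (auto simp: hasse_NC_def NC_covers_def finite_NC)
  show "symmetric (hasse_NC n)"
    by (auto simp: symmetric_def arcs_ends_conv hasse_NC_def with_proj_def sym_def)
qed (auto simp: hasse_NC_def NC_covers_def finite_NC)

text \<open>With all arc weights equal to 1, \<^const>\<open>wf_digraph.\<mu>\<close> is the least length of a walk, an
  extended real that is infinite if there is no walk. The conversion to a real number loses
  nothing, as lemma \<open>hasse_NC_reachable\<close> below shows.\<close>

definition d_H :: "nat \<Rightarrow> nat set set \<Rightarrow> nat set set \<Rightarrow> real" where
  "d_H n P R = real_of_ereal (wf_digraph.\<mu> (with_proj (hasse_NC n)) (\<lambda>_. 1) P R)"

definition Cat :: "nat \<Rightarrow> real" where
  "Cat n = fact (2 * n) / (fact n * fact (n + 1))"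

definition NC_bot :: "nat \<Rightarrow> nat set set" where
  "NC_bot n = (\<lambda>i. {i}) ` {1..n}"

lemma NC_bot_in_NC: "NC_bot n \<in> NC n"
  by (auto simp: NC_def NC_bot_def partition_on_def disjoint_def non_crossing_def)

lemma NC_bot_refines: assumes "P \<in> NC n" shows "refines {1..n} (NC_bot n) P"
  using assms NC_bot_in_NC[of n]
  by (fastforce simp: refines_def NC_def NC_bot_def partition_on_def)

lemma hasse_NC_reachable_bot:
  assumes "P \<in> NC n"
  shows "NC_bot n \<rightarrow>\<^sup>*\<^bsub>with_proj (hasse_NC n)\<^esub> P"
proof -
  interpret pair_graph "hasse_NC n" by (rule pair_graph_hasse_NC)
  define below where "below P = {S \<in> NC n. refines {1..n} S P}" for P
  have mono: "card (below S) < card (below Q)"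
    if "S \<in> NC n" "Q \<in> NC n" "refines {1..n} S Q" "S \<noteq> Q" for S Q
  proof (rule psubset_card_mono)
    show "finite (below Q)" by (simp add: below_def finite_NC)
    have "Q \<in> below Q" using that by (auto simp: below_def NC_def intro: refines_refl)
    moreover have "Q \<notin> below S" using that by (auto simp: below_def dest: refines_asym)
    moreover have "below S \<subseteq> below Q" using that by (auto simp: below_def intro: refines_trans)
    ultimately show "below S \<subset> below Q" by blast
  qed
  show ?thesis using assms
  proof (induction "card (below P)" arbitrary: P rule: less_induct)
    case less
    show ?case
    proof (cases "P = NC_bot n")
      case True
      have "P \<in> pverts (hasse_NC n)" using less.prems by (simp add: hasse_NC_def)
      then show ?thesis using True by (simp add: reachable_refl)
    next
      case False
      let ?A = "{S \<in> NC n. S \<noteq> P \<and> refines {1..n} S P}"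
      have "NC_bot n \<in> ?A" using False less.prems NC_bot_in_NC NC_bot_refines by auto
      moreover have "finite ?A" by (simp add: finite_NC)
      ultimately obtain S where S: "S \<in> ?A" "\<And>T. T \<in> ?A \<Longrightarrow> card (below T) \<le> card (below S)"
        using Max_in[of "(\<lambda>S. card (below S)) ` ?A"] Max_ge[of "(\<lambda>S. card (below S)) ` ?A"]
        by (smt (verit, ccfv_SIG) empty_iff finite_imageI image_iff image_is_empty)
      have cov: "NC_covers n S P"
        unfolding NC_covers_def
      proof (intro conjI notI)
        assume "\<exists>T\<in>NC n. T \<noteq> S \<and> T \<noteq> P \<and> refines {1..n} S T \<and> refines {1..n} T P"
        then obtain T where "T \<in> ?A" "S \<noteq> T" "refines {1..n} S T" by auto
        with S mono[of S T] show False by fastforce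
      qed (use S less.prems in auto)
      have "NC_bot n \<rightarrow>\<^sup>*\<^bsub>with_proj (hasse_NC n)\<^esub> S"
        by (rule less.hyps) (use S mono less.prems in auto)
      moreover have "(S, P) \<in> parcs (hasse_NC n)" using cov by (simp add: hasse_NC_def)
      ultimately show ?thesis using reachable_adj_trans by auto
    qed
  qed
qed

lemma hasse_NC_reachable:
  assumes "P \<in> NC n" "R \<in> NC n"
  shows "P \<rightarrow>\<^sup>*\<^bsub>with_proj (hasse_NC n)\<^esub> R"
proof -
  interpret pair_graph "hasse_NC n" by (rule pair_graph_hasse_NC)
  show ?thesis
    using assms hasse_NC_reachable_bot symmetric_reachable[OF pair_sym_arcs] reachable_trans
    by blast
qed

end

theory Submission
  imports Defs "HOL-Computational_Algebra.Formal_Power_Series"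
begin

text \<open>
  There is a bijection \<open>K\<close> of \<open>NC n\<close> with \<open>d\<^sub>H(\<pi>, K \<pi>) \<ge> n - 1\<close> for all \<open>\<pi>\<close> (in the role of
  the Kreweras complement). Summing
  \<open>d\<^sub>H(\<pi>, \<rho>) + d\<^sub>H(\<rho>, K \<pi>) \<ge> n - 1\<close> over all \<open>\<pi>\<close>, \<open>\<rho>\<close> gives the average.

  The lower bound only uses that an edge of the Hasse diagram merges or splits two blocks:
  \<open>d\<^sub>H(\<pi>, \<rho>) \<ge> |\<pi>| + |\<rho>| - 2 |\<pi> \<or> \<rho>|\<close>, with the join taken in the lattice of all partitions, and
  \<open>|\<pi>| + |K \<pi>| = n + 1\<close> while \<open>\<pi> \<or> K \<pi>\<close> is the one-block partition. Both partitions are read off a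
  binary tree with \<open>n\<close> nodes, in which every node is joined to the lowest, respectively the
  highest, point of its subtree.
\<close>

section \<open>Merging two blocks of a partition\<close>

text \<open>Indexed by two points rather than two blocks, so that the same \<open>x\<close> and
  \<open>y\<close> can act on a partition and on a coarsening of it at once. In a partition where
  they already share a block nothing changes.\<close>

definition merge :: "'a \<Rightarrow> 'a \<Rightarrow> 'a set set \<Rightarrow> 'a set set" where
  "merge x y P = insert (\<Union>{X\<in>P. x \<in> X \<or> y \<in> X}) {X\<in>P. x \<notin> X \<and> y \<notin> X}"

lemma partition_on_block_eq:
  "\<lbrakk>partition_on A P; X \<in> P; Y \<in> P; x \<in> X; x \<in> Y\<rbrakk> \<Longrightarrow> X = Y"
  by (auto simp: partition_on_def disjoint_def)

lemma partition_on_block_subset: "partition_on A P \<Longrightarrow> X \<in> P \<Longrightarrow> X \<subseteq> A"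
  by (auto simp: partition_on_def)

lemma partition_on_obtain_block:
  assumes "partition_on A P" "x \<in> A"
  obtains X where "X \<in> P" "x \<in> X"
  using assms by (auto simp: partition_on_def)

lemma merge_eq:
  assumes "partition_on A P" "V \<in> P" "W \<in> P" "x \<in> V" "y \<in> W"
  shows "merge x y P = insert (V \<union> W) (P - {V, W})"
proof -
  have "{X\<in>P. x \<in> X \<or> y \<in> X} = {V, W}" "{X\<in>P. x \<notin> X \<and> y \<notin> X} = P - {V, W}"
    using assms partition_on_block_eq[OF assms(1)] by blast+
  then show ?thesis by (simp add: merge_def)
qed

lemma partition_on_merge:
  assumes P: "partition_on A P" and "x \<in> A" "y \<in> A"
  shows "partition_on A (merge x y P)"
proof -
  obtain V W where VW: "V \<in> P" "x \<in> V" "W \<in> P" "y \<in> W"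
    using assms partition_on_obtain_block by metis
  show ?thesis unfolding merge_eq[OF P VW(1,3,2,4)]
    using P VW by (auto simp: partition_on_def disjoint_def)
qed

lemma refines_merge:
  assumes P: "partition_on A P" and xy: "x \<in> A" "y \<in> A"
  shows "refines A P (merge x y P)"
proof -
  obtain V W where VW: "V \<in> P" "x \<in> V" "W \<in> P" "y \<in> W"
    using assms partition_on_obtain_block by metis
  have "\<exists>Y\<in>merge x y P. X \<subseteq> Y" if "X \<in> P" for X
  proof (cases "X = V \<or> X = W")
    case True
    then show ?thesis unfolding merge_eq[OF P VW(1,3,2,4)] by auto
  next
    case False
    with that have "X \<in> merge x y P" unfolding merge_eq[OF P VW(1,3,2,4)] by simp
    then show ?thesis by blast
  qed
  then show ?thesis using partition_on_merge[OF P xy] P by (simp add: refines_def)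
qed

text \<open>With \<open>refines_merge\<close>, this makes \<open>merge x y P\<close> the least
  coarsening of \<open>P\<close> that puts \<open>x\<close> and \<open>y\<close> into one
  block.\<close>

lemma merge_refines:
  assumes "refines A P Q" "Y \<in> Q" "x \<in> Y" "y \<in> Y"
  shows "refines A (merge x y P) Q"
proof -
  have P: "partition_on A P" and Q: "partition_on A Q" using assms by (auto simp: refines_def)
  have xy: "x \<in> A" "y \<in> A" using Q assms by (auto simp: partition_on_def)
  obtain V W where VW: "V \<in> P" "x \<in> V" "W \<in> P" "y \<in> W"
    using xy P partition_on_obtain_block by metis
  have sub: "X \<subseteq> Y" if "X \<in> P" "z \<in> X" "z \<in> Y" for X z
  proof -
    obtain Y' where "Y' \<in> Q" "X \<subseteq> Y'" using assms(1) \<open>X \<in> P\<close> unfolding refines_def by blast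
    then show ?thesis using partition_on_block_eq[OF Q, of Y' Y z] that assms(2) by blast
  qed
  have "V \<union> W \<subseteq> Y" using VW sub[of V x] sub[of W y] assms by simp
  then have "\<exists>Y\<in>Q. X \<subseteq> Y" if "X \<in> merge x y P" for X
  proof (cases "X = V \<union> W")
    case True
    then show ?thesis using \<open>V \<union> W \<subseteq> Y\<close> \<open>Y \<in> Q\<close> by blast
  next
    case False
    then have "X \<in> P" using that unfolding merge_eq[OF P VW(1,3,2,4)] by simp
    then show ?thesis using assms(1) unfolding refines_def by blast
  qed
  then show ?thesis using partition_on_merge[OF P xy] Q by (simp add: refines_def)
qed

lemma card_merge_distinct:
  assumes P: "partition_on A P" "finite P" and "V \<in> P" "W \<in> P" "x \<in> V" "y \<in> W" "V \<noteq> W"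
  shows "card P = Suc (card (merge x y P))"
proof -
  \<comment> \<open>The inserted block is really new: the only block of \<open>P\<close> containing
    \<open>x\<close> is \<open>V\<close>, which has been removed.\<close>
  have "V \<union> W \<notin> P - {V, W}"
    using assms(5) partition_on_block_eq[OF P(1), of "V \<union> W" V x] \<open>V \<in> P\<close> by blast
  moreover have "card P = Suc (Suc (card (P - {V, W})))"
  proof -
    have "card {V, W} \<le> card P" using assms by (intro card_mono) auto
    then show ?thesis using assms card_Diff_subset[of "{V, W}" P] by auto
  qed
  ultimately show ?thesis
    using assms by (simp add: merge_eq[OF P(1) assms(3-6)])
qed

lemma merge_same_block:
  assumes "partition_on A P" "V \<in> P" "x \<in> V" "y \<in> V"
  shows "merge x y P = P"
  using merge_eq[OF assms(1,2,2,3,4)] assms by auto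

lemma card_merge_ge:
  assumes P: "partition_on A P" "finite P" and "x \<in> A" "y \<in> A"
  shows "card P \<le> Suc (card (merge x y P))"
proof -
  obtain V W where VW: "V \<in> P" "x \<in> V" "W \<in> P" "y \<in> W"
    using assms partition_on_obtain_block by metis
  show ?thesis
    using VW card_merge_distinct[OF P VW(1,3,2,4)] merge_same_block[OF P(1)]
    by (cases "V = W") auto
qed

text \<open>Merging commutes with injective relabelling; used later to reflect one tree encoding
  into the other.\<close>

lemma merge_image:
  assumes "inj_on f (\<Union>P)" "x \<in> \<Union>P" "y \<in> \<Union>P"
  shows "merge (f x) (f y) ((`) f ` P) = (`) f ` merge x y P"
proof -
  have *: "f z \<in> f ` X \<longleftrightarrow> z \<in> X" if "z \<in> \<Union>P" "X \<in> P" for z X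
    using inj_on_image_mem_iff[OF assms(1) that(1), of X] that(2) by blast
  have "{X \<in> (`) f ` P. f x \<in> X \<or> f y \<in> X} = (`) f ` {X\<in>P. x \<in> X \<or> y \<in> X}"
    "{X \<in> (`) f ` P. f x \<notin> X \<and> f y \<notin> X} = (`) f ` {X\<in>P. x \<notin> X \<and> y \<notin> X}"
    using *[OF assms(2)] *[OF assms(3)] by auto
  then show ?thesis by (simp add: merge_def image_Union)
qed

section \<open>Non-crossing partitions\<close>

lemma non_crossingD:
  assumes "non_crossing P" "V \<in> P" "W \<in> P" "a < b" "b < c" "c < d"
    "a \<in> V" "b \<in> W" "c \<in> V" "d \<in> W"
  shows "V = W"
proof (rule ccontr)
  assume "V \<noteq> W"
  then have "\<exists>V\<in>P. \<exists>W\<in>P. V \<noteq> W \<and>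
      (\<exists>a b c d. a < b \<and> b < c \<and> c < d \<and> a \<in> V \<and> c \<in> V \<and> b \<in> W \<and> d \<in> W)"
    using assms(2-) by (intro bexI[of _ V] bexI[of _ W] exI conjI)
  then show False using assms(1) unfolding non_crossing_def by simp
qed

text \<open>The points of \<open>U\<close> cut the circle into gaps: \<open>z\<close> and \<open>w\<close> lie in the same one iff no point of \<open>U\<close>
  is between them, or all points of \<open>U\<close> are.\<close>

definition same_gap :: "nat set \<Rightarrow> nat \<Rightarrow> nat \<Rightarrow> bool" where
  "same_gap U z w \<longleftrightarrow> (\<forall>u\<in>U. u < z \<longleftrightarrow> u < w) \<or> (\<forall>u\<in>U. u < z \<longleftrightarrow> \<not> u < w)"

lemma same_gap_refl: "same_gap U z z"
  by (simp add: same_gap_def)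

lemma same_gap_sym: "same_gap U z w \<Longrightarrow> same_gap U w z"
  unfolding same_gap_def by blast

text \<open>Two points either compare equally to every \<open>u\<close> or oppositely to every
  \<open>u\<close>, and these alternatives compose like signs.\<close>

lemma same_gap_trans: "same_gap U z v \<Longrightarrow> same_gap U v w \<Longrightarrow> same_gap U z w"
  unfolding same_gap_def by blast

lemma same_gap_wlog_less:
  assumes "\<And>z w. z \<in> V \<Longrightarrow> w \<in> V \<Longrightarrow> z < w \<Longrightarrow> same_gap U z w" "z \<in> V" "w \<in> V"
  shows "same_gap U z w"
proof (cases z w rule: linorder_cases)
  case greater
  then show ?thesis using assms by (simp add: same_gap_sym)
qed (use assms in \<open>simp_all add: same_gap_refl\<close>)

lemma same_gapI:
  assumes "x < y" "x \<notin> U" "y \<notin> U" "U \<inter> {x<..<y} = {} \<or> U \<subseteq> {x<..<y}"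
  shows "same_gap U x y"
proof -
  have "u < x \<longleftrightarrow> u < y" if "u \<in> U" "U \<inter> {x<..<y} = {}" for u
    using that assms by (metis IntI emptyE greaterThanLessThan_iff linorder_neqE_nat order.strict_trans)
  moreover have "u < x \<longleftrightarrow> \<not> u < y" if "u \<in> U" "U \<subseteq> {x<..<y}" for u
    using that by fastforce
  ultimately show ?thesis using assms(4) unfolding same_gap_def by blast
qed

lemma not_same_gap_crossing:
  assumes "z < w" "z \<notin> U" "w \<notin> U" "\<not> same_gap U z w"
  obtains u u' where "u \<in> U" "u' \<in> U" "z < u" "u < w" "u' < z \<or> w < u'"
proof -
  have "\<not> (U \<inter> {z<..<w} = {} \<or> U \<subseteq> {z<..<w})"
    using same_gapI[OF assms(1-3)] assms(4) by blast
  then obtain u u' where u: "u \<in> U" "u' \<in> U" "z < u" "u < w" "\<not> (z < u' \<and> u' < w)"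
    by (meson disjoint_iff greaterThanLessThan_iff subsetI)
  moreover have "u' \<noteq> z" "u' \<noteq> w" using u(2) assms(2,3) by auto
  ultimately show thesis using that by force
qed

text \<open>Rephrases crossings as gap membership, so that later arguments need only reflexivity,
  symmetry and transitivity of \<open>same_gap\<close> instead of ordered quadruples.\<close>

lemma non_crossing_iff_same_gap:
  assumes "partition_on A P"
  shows "non_crossing P \<longleftrightarrow> (\<forall>U\<in>P. \<forall>V\<in>P. U \<noteq> V \<longrightarrow> (\<forall>z\<in>V. \<forall>w\<in>V. same_gap U z w))"
proof
  assume nc: "non_crossing P"
  have lt: "same_gap U z w" if "U \<in> P" "V \<in> P" "U \<noteq> V" "z \<in> V" "w \<in> V" "z < w" for U V z w
  proof (rule ccontr)
    assume ns: "\<not> same_gap U z w"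
    have "z \<notin> U" "w \<notin> U" using that partition_on_block_eq[OF assms] by blast+
    then obtain u u' where u: "u \<in> U" "u' \<in> U" "z < u" "u < w" "u' < z \<or> w < u'"
      using not_same_gap_crossing[OF \<open>z < w\<close> _ _ ns] by metis
    from u(5) show False
    proof
      assume "u' < z"
      then show False using non_crossingD[OF nc \<open>U \<in> P\<close> \<open>V \<in> P\<close> _ \<open>z < u\<close> \<open>u < w\<close>] u that by blast
    next
      assume "w < u'"
      then show False using non_crossingD[OF nc \<open>V \<in> P\<close> \<open>U \<in> P\<close> \<open>z < u\<close> \<open>u < w\<close>] u that by blast
    qed
  qed
  show "\<forall>U\<in>P. \<forall>V\<in>P. U \<noteq> V \<longrightarrow> (\<forall>z\<in>V. \<forall>w\<in>V. same_gap U z w)"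
  proof (intro ballI impI)
    fix U V z w assume UV: "U \<in> P" "V \<in> P" "U \<noteq> V" "z \<in> V" "w \<in> V"
    show "same_gap U z w" by (rule same_gap_wlog_less[OF lt[OF UV(1-3)] UV(4,5)])
  qed
next
  assume sg: "\<forall>U\<in>P. \<forall>V\<in>P. U \<noteq> V \<longrightarrow> (\<forall>z\<in>V. \<forall>w\<in>V. same_gap U z w)"
  show "non_crossing P" unfolding non_crossing_def
  proof clarify
    fix V W a b c d
    assume "V \<in> P" "W \<in> P" "V \<noteq> W" "a < b" "b < c" "c < (d::nat)" "a \<in> V" "c \<in> V" "b \<in> W" "d \<in> W"
    then have "same_gap W a c" using sg by blast
    moreover have "\<not> b < a" "b < c" "\<not> d < a" "\<not> d < c"
      using \<open>a < b\<close> \<open>b < c\<close> \<open>c < d\<close> by auto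
    ultimately show False using \<open>b \<in> W\<close> \<open>d \<in> W\<close> unfolding same_gap_def by blast
  qed
qed

text \<open>Crossing is a symmetric relation of two blocks: points of \<open>V\<close> that separate
  two points of \<open>U\<close> are themselves separated by those two.\<close>

lemma same_gap_swap:
  assumes sg: "\<And>z w. z \<in> V \<Longrightarrow> w \<in> V \<Longrightarrow> same_gap U z w" and "U \<inter> V = {}" "z \<in> U" "w \<in> U"
  shows "same_gap V z w"
proof (rule same_gap_wlog_less[OF _ assms(3,4)], rule ccontr)
  fix z w assume zw: "z \<in> U" "w \<in> U" "z < w" and ns: "\<not> same_gap V z w"
  have "z \<notin> V" "w \<notin> V" using zw assms(2) by blast+
  from not_same_gap_crossing[OF \<open>z < w\<close> this ns]
  obtain u u' where u: "u \<in> V" "u' \<in> V" "z < u" "u < w" "u' < z \<or> w < u'" .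
  \<comment> \<open>The same alternative of \<open>same_gap\<close> has to hold at both
    \<open>z\<close> and \<open>w\<close>; either one contradicts \<open>u\<close> lying between
    them and \<open>u'\<close> outside.\<close>
  have "(z < u \<longleftrightarrow> z < u') \<and> (w < u \<longleftrightarrow> w < u') \<or> (z < u \<longleftrightarrow> \<not> z < u') \<and> (w < u \<longleftrightarrow> \<not> w < u')"
    using sg[OF u(1,2)] zw unfolding same_gap_def by blast
  then show False using u(3-5) zw(3) by auto
qed

text \<open>If no other block separates \<open>x\<close> from \<open>y\<close>, transitivity puts
  the whole merged block into one gap of each other block. \<open>same_gap_swap\<close> then puts
  each other block into one gap of the merged one.\<close>

lemma non_crossing_merge:
  assumes P: "partition_on A P" and nc: "non_crossing P" and xy: "x \<in> A" "y \<in> A"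
    and gap: "\<And>U. U \<in> P \<Longrightarrow> x \<notin> U \<Longrightarrow> y \<notin> U \<Longrightarrow> same_gap U x y"
  shows "non_crossing (merge x y P)"
proof -
  obtain V W where VW: "V \<in> P" "x \<in> V" "W \<in> P" "y \<in> W"
    using P xy partition_on_obtain_block by metis
  note m = merge_eq[OF P VW(1,3,2,4)]
  have sg: "same_gap U z w" if "U \<in> P" "X \<in> P" "U \<noteq> X" "z \<in> X" "w \<in> X" for U X z w
    using nc non_crossing_iff_same_gap[OF P] that by blast
  have VWsg: "same_gap U z w" if "U \<in> P - {V, W}" "z \<in> V \<union> W" "w \<in> V \<union> W" for U z w
  proof -
    have xU: "x \<notin> U" "y \<notin> U" using that(1) VW partition_on_block_eq[OF P] by blast+
    have "same_gap U x z" if "z \<in> V \<union> W" for z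
    proof (cases "z \<in> V")
      case True then show ?thesis using sg \<open>U \<in> P - {V, W}\<close> VW by blast
    next
      case False
      then have "same_gap U y z" using sg that \<open>U \<in> P - {V, W}\<close> VW by blast
      then show ?thesis using gap xU \<open>U \<in> P - {V, W}\<close> same_gap_trans by blast
    qed
    then show ?thesis using that same_gap_trans same_gap_sym by blast
  qed
  have "same_gap U z w"
    if UX: "U \<in> merge x y P" "X \<in> merge x y P" "U \<noteq> X" and zw: "z \<in> X" "w \<in> X" for U X z w
  proof -
    consider "U = V \<union> W" "X \<in> P - {V, W}" | "X = V \<union> W" "U \<in> P - {V, W}"
      | "U \<in> P" "X \<in> P" using UX unfolding m by blast
    then show ?thesis
    proof cases
      case 1
      have "X \<inter> U = {}" using 1 VW partition_on_block_eq[OF P] by blast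
      then show ?thesis using same_gap_swap[of U X z w] VWsg 1 zw by blast
    qed (use VWsg sg UX zw in blast)+
  qed
  then show ?thesis using non_crossing_iff_same_gap[OF partition_on_merge[OF P xy]] by blast
qed

section \<open>Distances in the Hasse diagram\<close>

lemma NC_D:
  assumes "P \<in> NC n"
  shows "partition_on {1..n} P" "non_crossing P" "finite P"
  using assms finite_elements[of "{1..n}" P] by (auto simp: NC_def)

text \<open>If \<open>U\<close> separated \<open>x\<close> from \<open>y\<close>, the block of
  \<open>R\<close> containing \<open>U\<close> would cross \<open>B\<close> unless it were
  \<open>B\<close> itself. In that case \<open>U\<close> has a point of \<open>B\<close> between
  \<open>x\<close> and \<open>y\<close>, which \<open>min\<close> assigns to the block of
  \<open>x\<close> or of \<open>y\<close>.\<close>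

lemma same_gap_refinement:
  assumes P: "partition_on A P" and R: "partition_on A R" "non_crossing R" and ref: "refines A P R"
    and B: "B \<in> R" "x \<in> B" "y \<in> B" and "x < y"
    and min: "\<And>u. u \<in> B \<Longrightarrow> x < u \<Longrightarrow> u < y \<Longrightarrow> \<exists>X\<in>P. u \<in> X \<and> (x \<in> X \<or> y \<in> X)"
    and U: "U \<in> P" "x \<notin> U" "y \<notin> U"
  shows "same_gap U x y"
proof (rule ccontr)
  assume ns: "\<not> same_gap U x y"
  obtain u u' where u: "u \<in> U" "u' \<in> U" "x < u" "u < y" "u' < x \<or> y < u'"
    using not_same_gap_crossing[OF \<open>x < y\<close> U(2,3) ns] .
  obtain B' where B': "B' \<in> R" "U \<subseteq> B'" using ref U(1) unfolding refines_def by blast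
  have "u \<notin> B"
  proof
    assume "u \<in> B"
    from min[OF this u(3,4)] obtain X where X: "X \<in> P" "u \<in> X" "x \<in> X \<or> y \<in> X" by blast
    then have "X = U" using partition_on_block_eq[OF P] U(1) u(1) by blast
    then show False using X(3) U(2,3) by blast
  qed
  have uB: "u \<in> B'" "u' \<in> B'" using u B' by auto
  from u(5) have "B = B'"
  proof
    assume "u' < x"
    from non_crossingD[OF R(2) B'(1) B(1) this u(3,4)] uB B(2,3) show ?thesis by simp
  next
    assume "y < u'"
    from non_crossingD[OF R(2) B(1) B'(1) u(3,4) this] uB B(2,3) show ?thesis by simp
  qed
  then show False using \<open>u \<notin> B\<close> uB by simp
qed

lemma proper_refinement_split_block:
  assumes "refines A P R" "P \<noteq> R"
  obtains B x y where "B \<in> R" "x \<in> B" "y \<in> B" "\<And>X. X \<in> P \<Longrightarrow> x \<in> X \<Longrightarrow> y \<notin> X"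
proof -
  have P: "partition_on A P" and R: "partition_on A R" using assms by (auto simp: refines_def)
  have "\<not> refines A R P" using refines_asym assms by blast
  then obtain B where B: "B \<in> R" "\<And>X. X \<in> P \<Longrightarrow> \<not> B \<subseteq> X"
    using P R unfolding refines_def by blast
  then obtain x where x: "x \<in> B" using R by (metis ex_in_conv partition_onD3)
  then obtain X where X: "X \<in> P" "x \<in> X"
    using partition_on_obtain_block[OF P] B(1) partition_onD1[OF R] by blast
  obtain y where y: "y \<in> B" "y \<notin> X" using B(2)[OF X(1)] by blast
  show thesis
  proof (rule that[OF B(1) x y(1)])
    fix X' assume "X' \<in> P" "x \<in> X'"
    then have "X' = X" using partition_on_block_eq[OF P] X by blast
    then show "y \<notin> X'" using y by simp
  qed
qed

text \<open>The merged pair is a closest one among those joined in \<open>R\<close> but not in \<open>P\<close>: then no block of \<open>P\<close>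
  separates \<open>x\<close> from \<open>y\<close>, so that merging keeps the partition non-crossing.\<close>

lemma NC_covers_merge:
  assumes cov: "NC_covers n P R"
  obtains x y V W where "V \<in> P" "W \<in> P" "x \<in> V" "y \<in> W" "V \<noteq> W" "R = merge x y P"
proof -
  have PR: "P \<in> NC n" "R \<in> NC n" "P \<noteq> R" and ref: "refines {1..n} P R"
    using cov by (auto simp: NC_covers_def)
  note P = NC_D[OF PR(1)] and R = NC_D[OF PR(2)]
  define split where "split x y \<longleftrightarrow>
    x < y \<and> (\<exists>B\<in>R. x \<in> B \<and> y \<in> B) \<and> (\<forall>X\<in>P. \<not> (x \<in> X \<and> y \<in> X))" for x y
  obtain B x y where Bxy: "B \<in> R" "x \<in> B" "y \<in> B" "\<And>X. X \<in> P \<Longrightarrow> x \<in> X \<Longrightarrow> y \<notin> X"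
    using proper_refinement_split_block[OF ref PR(3)] by blast
  have "x \<noteq> y"
    using partition_on_obtain_block[OF P(1), of x] Bxy partition_onD1[OF R(1)] by blast
  then have "split x y \<or> split y x" unfolding split_def using Bxy by auto
  then have "\<exists>p. case_prod split p" by auto
  then obtain p where p: "case_prod split p"
    and p_min: "\<And>q. case_prod split q \<Longrightarrow> snd p - fst p \<le> snd q - fst q"
    using ex_has_least_nat[of "case_prod split" _ "\<lambda>q. snd q - fst q"] by blast
  define x y where "x = fst p" and "y = snd p"
  have xy: "split x y" using p by (simp add: x_def y_def case_prod_unfold)
  have least: "y - x \<le> w - z" if "split z w" for z w
    using p_min[of "(z, w)"] that by (simp add: x_def y_def)
  obtain B where B: "B \<in> R" "x \<in> B" "y \<in> B" and "x < y"
    and sep: "\<And>X. X \<in> P \<Longrightarrow> \<not> (x \<in> X \<and> y \<in> X)"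
    using xy unfolding split_def by auto
  have A: "x \<in> {1..n}" "y \<in> {1..n}" using B partition_onD1[OF R(1)] by blast+
  obtain V W where VW: "V \<in> P" "x \<in> V" "W \<in> P" "y \<in> W"
    using partition_on_obtain_block[OF P(1)] A by metis
  have near: "\<exists>X\<in>P. u \<in> X \<and> (x \<in> X \<or> y \<in> X)" if "u \<in> B" "x < u" "u < y" for u
  proof -
    have "\<not> split x u" using least[of x u] that by auto
    then show ?thesis using that B unfolding split_def by auto
  qed
  have "non_crossing (merge x y P)"
    by (rule non_crossing_merge[OF P(1,2) A])
      (rule same_gap_refinement[OF P(1) R(1,2) ref B \<open>x < y\<close> near])
  then have "merge x y P \<in> NC n" using partition_on_merge[OF P(1) A] by (simp add: NC_def)
  moreover have "merge x y P \<noteq> P"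
  proof
    assume "merge x y P = P"
    then have "V \<union> W \<in> P" using merge_eq[OF P(1) VW(1,3,2,4)] by blast
    then show False using sep[of "V \<union> W"] VW by simp
  qed
  moreover have "refines {1..n} P (merge x y P)" by (rule refines_merge[OF P(1) A])
  moreover have "refines {1..n} (merge x y P) R" by (rule merge_refines[OF ref B])
  \<comment> \<open>The merged partition lies in \<open>NC n\<close>, strictly above
    \<open>P\<close> and below \<open>R\<close>; a cover leaves only \<open>R\<close>.\<close>
  ultimately have "R = merge x y P" using cov unfolding NC_covers_def by blast
  moreover have "V \<noteq> W" using sep VW by auto
  ultimately show thesis using that VW by blast
qed

text \<open>The invariant does not need the join of \<open>P\<close> and \<open>Q\<close>: going up along an edge \<open>merge x y\<close>, the
  coarsening \<open>T\<close> is replaced by \<open>merge x y T\<close>; going down, \<open>T\<close> is kept.\<close>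

lemma awalk_common_coarsening:
  assumes "pre_digraph.awalk (with_proj (hasse_NC n)) P p Q"
  shows "\<exists>T. refines {1..n} P T \<and> refines {1..n} Q T \<and> card P + card Q \<le> 2 * card T + length p"
proof -
  interpret pair_graph "hasse_NC n" by (rule pair_graph_hasse_NC)
  show ?thesis using assms
  proof (induction p arbitrary: P)
    case Nil
    then have "P = Q" "P \<in> pverts (hasse_NC n)" by (auto simp: awalk_Nil_iff)
    then have "P = Q" "P \<in> NC n" by (simp_all add: hasse_NC_def)
    then show ?case using refines_refl NC_D(1) by force
  next
    case (Cons e p)
    obtain P' where e: "e = (P, P')" and arc: "NC_covers n P P' \<or> NC_covers n P' P"
      and walk: "awalk P' p Q"
    proof -
      have "e \<in> parcs (hasse_NC n)" "fst e = P" "awalk (snd e) p Q"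
        using Cons.prems by (auto simp: awalk_Cons_iff)
      then show thesis using that[of "snd e"] by (cases e) (simp add: hasse_NC_def)
    qed
    from Cons.IH[OF walk] obtain T where T: "refines {1..n} P' T" "refines {1..n} Q T"
      "card P' + card Q \<le> 2 * card T + length p" by blast
    from arc show ?case
    proof
      assume cov: "NC_covers n P P'"
      then have ref: "refines {1..n} P P'" and "P \<in> NC n" by (auto simp: NC_covers_def)
      note P = NC_D[OF this(2)]
      from NC_covers_merge[OF cov] have "card P = Suc (card P')"
        using card_merge_distinct[OF P(1,3)] by metis
      then show ?thesis using T refines_trans[OF ref T(1)] by (intro exI[of _ T]) simp
    next
      assume cov: "NC_covers n P' P"
      then have "P' \<in> NC n" by (auto simp: NC_covers_def)
      note P' = NC_D[OF this]
      obtain x y V W where m: "V \<in> P'" "W \<in> P'" "x \<in> V" "y \<in> W" "V \<noteq> W" "P = merge x y P'"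
        using NC_covers_merge[OF cov] .
      have "card P' = Suc (card P)" using card_merge_distinct[OF P'(1,3) m(1-5)] m(6) by simp
      moreover have A: "x \<in> {1..n}" "y \<in> {1..n}" using m partition_onD1[OF P'(1)] by auto
      have pT: "partition_on {1..n} T" using T(1) by (simp add: refines_def)
      \<comment> \<open>\<open>T\<close> may lose one block, which costs 2 on the right; this is
        paid for by the block lost on the left and the additional arc of the walk.\<close>
      have "card T \<le> Suc (card (merge x y T))"
        by (rule card_merge_ge[OF pT finite_elements[OF _ pT] A]) simp
      moreover have T': "refines {1..n} T (merge x y T)" by (rule refines_merge[OF pT A])
      have "refines {1..n} P (merge x y T)"
      proof -
        obtain X Y where XY: "X \<in> T" "x \<in> X" "Y \<in> T" "y \<in> Y"
          using partition_on_obtain_block[OF pT] A by metis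
        have "X \<union> Y \<in> merge x y T" using merge_eq[OF pT XY(1,3,2,4)] by blast
        from merge_refines[OF refines_trans[OF T(1) T'] this, of x y] XY
        show ?thesis using m(6) by blast
      qed
      ultimately show ?thesis using T refines_trans[OF T(2) T']
        by (intro exI[of _ "merge x y T"]) simp
    qed
  qed
qed

section \<open>Graph distance as the length of a shortest walk\<close>

lemma (in wf_digraph) awalk_cost_one: "awalk_cost (\<lambda>_. 1) p = real (length p)"
  by (induction p) auto

text \<open>Reachability makes the infimum \<open>\<mu>\<close> attained, so the passage to a real
  number gives the length of an actual walk.\<close>

lemma d_H_shortest_walk:
  assumes "P \<in> NC n" "R \<in> NC n"
  obtains p where "pre_digraph.awalk (with_proj (hasse_NC n)) P p R" "d_H n P R = real (length p)"
proof -
  interpret pair_graph "hasse_NC n" by (rule pair_graph_hasse_NC)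
  obtain p where "apath P p R" "\<mu> (\<lambda>_. 1) P R = awalk_cost (\<lambda>_. 1) p"
    using min_cost_awalk[OF hasse_NC_reachable[OF assms], of "\<lambda>_. 1"] by auto
  then show thesis using that[of p] by (auto simp: d_H_def apath_def awalk_cost_one)
qed

lemma d_H_le_length:
  assumes "pre_digraph.awalk (with_proj (hasse_NC n)) P p R"
  shows "d_H n P R \<le> real (length p)"
proof -
  interpret pair_graph "hasse_NC n" by (rule pair_graph_hasse_NC)
  have "\<mu> (\<lambda>_. 1) P R \<le> ereal (length p)"
    using min_cost_le_walk_cost[OF assms, of "\<lambda>_. 1"] by (simp add: awalk_cost_one)
  \<comment> \<open>The bound rules out the value plus infinity; \<open>real_of_ereal\<close> sends
    minus infinity to 0, for which the claim is clear.\<close>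
  then show ?thesis unfolding d_H_def by (cases "\<mu> (\<lambda>_. 1) P R") auto
qed

lemma d_H_triangle:
  assumes "P \<in> NC n" "Q \<in> NC n" "R \<in> NC n"
  shows "d_H n P R \<le> d_H n P Q + d_H n Q R"
proof -
  interpret pair_graph "hasse_NC n" by (rule pair_graph_hasse_NC)
  obtain p where p: "awalk P p Q" "d_H n P Q = real (length p)"
    using d_H_shortest_walk[OF assms(1,2)] .
  obtain q where q: "awalk Q q R" "d_H n Q R = real (length q)"
    using d_H_shortest_walk[OF assms(2,3)] .
  show ?thesis using d_H_le_length[OF awalk_appendI[OF p(1) q(1)]] p q by simp
qed

text \<open>The hypothesis \<open>join\<close> says that the join has at most one block, in the form
  that the walk invariant delivers its coarsening \<open>T\<close>.\<close>

lemma d_H_ge: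
  assumes PQ: "P \<in> NC n" "Q \<in> NC n"
    and join: "\<And>T. refines {1..n} P T \<Longrightarrow> refines {1..n} Q T \<Longrightarrow> card T \<le> 1"
  shows "real (card P) + real (card Q) - 2 \<le> d_H n P Q"
proof -
  obtain p where p: "pre_digraph.awalk (with_proj (hasse_NC n)) P p Q" "d_H n P Q = real (length p)"
    using d_H_shortest_walk[OF PQ] .
  obtain T where "refines {1..n} P T" "refines {1..n} Q T" "card P + card Q \<le> 2 * card T + length p"
    using awalk_common_coarsening[OF p(1)] by blast
  then show ?thesis using join[of T] p(2) by simp
qed

section \<open>Encoding non-crossing partitions by binary trees\<close>

text \<open>General ground sets are needed because subtrees occupy shifted intervals.\<close>

abbreviation NC_on :: "nat set \<Rightarrow> nat set set set" where
  "NC_on A \<equiv> {P. partition_on A P \<and> non_crossing P}"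

lemma same_gap_mono: "same_gap U z w \<Longrightarrow> U' \<subseteq> U \<Longrightarrow> same_gap U' z w"
  unfolding same_gap_def by blast

text \<open>A block lying entirely below or entirely above \<open>U\<close> cannot be cut by
  it.\<close>

lemma NC_on_append:
  assumes "P \<in> NC_on S" "Q \<in> NC_on T" and less: "\<And>s t. s \<in> S \<Longrightarrow> t \<in> T \<Longrightarrow> s < t"
  shows "P \<union> Q \<in> NC_on (S \<union> T)"
proof -
  have P: "partition_on S P" "non_crossing P" and Q: "partition_on T Q" "non_crossing Q"
    using assms by auto
  have sub: "X \<subseteq> S" if "X \<in> P" for X using partition_on_block_subset[OF P(1) that] .
  have subT: "X \<subseteq> T" if "X \<in> Q" for X using partition_on_block_subset[OF Q(1) that] .
  have "S \<inter> T = {}" using less by blast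
  have PQ: "partition_on (S \<union> T) (P \<union> Q)"
  proof (rule partition_onI)
    show "\<Union>(P \<union> Q) = S \<union> T" using partition_onD1[OF P(1)] partition_onD1[OF Q(1)] by simp
    show "{} \<notin> P \<union> Q" using partition_onD3[OF P(1)] partition_onD3[OF Q(1)] by simp
    fix p q assume pq: "p \<in> P \<union> Q" "q \<in> P \<union> Q" "p \<noteq> q"
    consider "p \<in> P" "q \<in> P" | "p \<in> Q" "q \<in> Q" | "p \<in> P" "q \<in> Q" | "p \<in> Q" "q \<in> P"
      using pq by blast
    then show "disjnt p q"
    proof cases
      case 1 then show ?thesis
        using partition_onD2[OF P(1)] pq(3) by (simp add: disjoint_def disjnt_def)
    next
      case 2 then show ?thesis
        using partition_onD2[OF Q(1)] pq(3) by (simp add: disjoint_def disjnt_def)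
    next
      case 3 then show ?thesis
        using sub[of p] subT[of q] \<open>S \<inter> T = {}\<close> unfolding disjnt_def by blast
    next
      case 4 then show ?thesis
        using sub[of q] subT[of p] \<open>S \<inter> T = {}\<close> unfolding disjnt_def by blast
    qed
  qed
  have "same_gap U z w" if UV: "U \<in> P \<union> Q" "V \<in> P \<union> Q" "U \<noteq> V" and zw: "z \<in> V" "w \<in> V" for U V z w
  proof -
    consider "U \<in> P" "V \<in> P" | "U \<in> Q" "V \<in> Q" | "U \<in> P" "V \<in> Q" | "U \<in> Q" "V \<in> P"
      using UV by blast
    then show ?thesis
    proof cases
      case 1 then show ?thesis using non_crossing_iff_same_gap[OF P(1)] P(2) UV(3) zw by simp
    next
      case 2 then show ?thesis using non_crossing_iff_same_gap[OF Q(1)] Q(2) UV(3) zw by simp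
    next
      case 3
      then have "u < z" "u < w" if "u \<in> U" for u using less sub subT zw that by blast+
      then show ?thesis by (simp add: same_gap_def)
    next
      case 4
      then have "z < u" "w < u" if "u \<in> U" for u using less sub subT zw that by blast+
      then show ?thesis by (simp add: same_gap_def less_not_sym)
    qed
  qed
  then show ?thesis using PQ non_crossing_iff_same_gap[OF PQ] by simp
qed

lemma NC_on_singleton: "{{m}} \<in> NC_on {m}"
  by (auto simp: partition_on_def non_crossing_def)

lemma NC_on_restrict:
  assumes "P \<in> NC_on A"
  shows "(\<inter>) S ` P - {{}} \<in> NC_on (S \<inter> A)"
proof -
  have P: "partition_on A P" "non_crossing P" using assms by auto
  note R = partition_on_restrict[OF P(1), of S]
  have "same_gap U' z w"
    if UV: "U' \<in> (\<inter>) S ` P - {{}}" "V' \<in> (\<inter>) S ` P - {{}}" "U' \<noteq> V'" and zw: "z \<in> V'" "w \<in> V'"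
    for U' V' z w
  proof -
    obtain U V where *: "U \<in> P" "V \<in> P" "U' = S \<inter> U" "V' = S \<inter> V" using UV by blast
    then have "same_gap U z w"
      using non_crossing_iff_same_gap[OF P(1)] P(2) UV(3) zw by (metis IntD2)
    then show ?thesis using * by (auto intro: same_gap_mono)
  qed
  then show ?thesis using R non_crossing_iff_same_gap[OF R] by simp
qed

text \<open>An order reversal turns a crossing of two blocks into a crossing with their roles
  exchanged.\<close>

lemma NC_on_image_antimono:
  fixes f :: "nat \<Rightarrow> nat"
  assumes "P \<in> NC_on A" and f: "\<And>x y. x \<in> A \<Longrightarrow> y \<in> A \<Longrightarrow> f x < f y \<longleftrightarrow> y < x"
  shows "(`) f ` P \<in> NC_on (f ` A)"
proof -
  have P: "partition_on A P" "non_crossing P" using assms by auto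
  have inj: "inj_on f A" using f by (metis inj_onI less_irrefl linorder_neqE_nat)
  have "{} \<notin> (`) f ` P" using partition_onD3[OF P(1)] by auto
  then have "partition_on (f ` A) ((`) f ` P)" using partition_on_inj_image[OF P(1) inj] by simp
  moreover have "non_crossing ((`) f ` P)" unfolding non_crossing_def
  proof clarify
    fix V W a b c d
    assume *: "V \<in> P" "W \<in> P" "f ` V \<noteq> f ` W" "f a < f b" "f b < f c" "f c < f d"
      "a \<in> V" "c \<in> V" "b \<in> W" "d \<in> W"
    then have "a \<in> A" "b \<in> A" "c \<in> A" "d \<in> A" using partition_onD1[OF P(1)] by blast+
    then have "d < c" "c < b" "b < a" using * f by blast+
    then have "W = V" using non_crossingD[OF P(2) *(2,1)] * by blast
    then show False using *(3) by simp
  qed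
  ultimately show ?thesis by simp
qed

section \<open>Binary trees and the partitions they encode\<close>

datatype btree = Leaf | Node btree btree

lemma size_eq_0_iff_Leaf: "size t = 0 \<longleftrightarrow> t = Leaf"
  by (cases t) simp_all

fun mirror :: "btree \<Rightarrow> btree" where
  "mirror Leaf = Leaf"
| "mirror (Node a b) = Node (mirror b) (mirror a)"

definition glue :: "nat \<Rightarrow> nat set set \<Rightarrow> nat set set \<Rightarrow> nat set set" where
  "glue m A B = A \<union> ({{m}} \<union> B)"

text \<open>\<open>low_join t l\<close> and \<open>high_join t l\<close> partition the \<open>size t\<close> points after \<open>l\<close>, the nodes of \<open>t\<close>
  in symmetric order. Each node is joined to the lowest, respectively the highest, point of its
  subtree. If the corresponding child is a leaf, that point is the node itself and nothing is merged.\<close>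

fun low_join :: "btree \<Rightarrow> nat \<Rightarrow> nat set set" where
  "low_join Leaf l = {}"
| "low_join (Node a b) l = (let m = Suc (l + size a) in
     merge (Suc l) m (glue m (low_join a l) (low_join b m)))"

fun high_join :: "btree \<Rightarrow> nat \<Rightarrow> nat set set" where
  "high_join Leaf l = {}"
| "high_join (Node a b) l = (let m = Suc (l + size a) in
     merge m (m + size b) (glue m (high_join a l) (high_join b m)))"

lemma size_mirror [simp]: "size (mirror t) = size t"
  by (induction t) auto

lemma mirror_mirror [simp]: "mirror (mirror t) = t"
  by (induction t) auto

lemma NC_on_glue:
  assumes "A \<in> NC_on {l<..l + i}" "B \<in> NC_on {Suc (l + i)<..Suc (l + i) + j}"
  shows "glue (Suc (l + i)) A B \<in> NC_on {l<..Suc (l + i) + j}"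
proof -
  have 1: "{{Suc (l + i)}} \<union> B \<in> NC_on ({Suc (l + i)} \<union> {Suc (l + i)<..Suc (l + i) + j})"
    by (rule NC_on_append[OF NC_on_singleton assms(2)]) auto
  have "glue (Suc (l + i)) A B
      \<in> NC_on ({l<..l + i} \<union> ({Suc (l + i)} \<union> {Suc (l + i)<..Suc (l + i) + j}))"
    unfolding glue_def by (rule NC_on_append[OF assms(1) 1]) auto
  moreover have "{l<..l + i} \<union> ({Suc (l + i)} \<union> {Suc (l + i)<..Suc (l + i) + j})
      = {l<..Suc (l + i) + j}" by auto
  ultimately show ?thesis by simp
qed

text \<open>Strictly between \<open>Suc l\<close> and \<open>m\<close> there are only points of the
  left part, so a block avoiding both lies wholly inside or wholly outside that interval. For
  \<open>i = 0\<close> the two points coincide.\<close>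

lemma NC_on_merge_glue:
  assumes A: "A \<in> NC_on {l<..l + i}" and B: "B \<in> NC_on {m<..m + j}" and m: "m = Suc (l + i)"
  shows "merge (Suc l) m (glue m A B) \<in> NC_on {l<..m + j}"
proof -
  have g: "partition_on {l<..m + j} (glue m A B)" "non_crossing (glue m A B)"
    using NC_on_glue[OF A, of B j] B m by auto
  have A': "partition_on {l<..l + i} A" and B': "partition_on {m<..m + j} B" using A B by auto
  have xy: "Suc l \<in> {l<..m + j}" "m \<in> {l<..m + j}" using m by auto
  have "same_gap U (Suc l) m" if U: "U \<in> glue m A B" "Suc l \<notin> U" "m \<notin> U" for U
  proof (cases "i = 0")
    case True
    then show ?thesis using m by (simp add: same_gap_refl)
  next
    case False
    have "U \<in> A \<or> U \<in> B" using U unfolding glue_def by blast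
    then have "U \<inter> {Suc l<..<m} = {} \<or> U \<subseteq> {Suc l<..<m}"
    proof
      assume "U \<in> A"
      then have "U \<subseteq> {l<..l + i}" by (rule partition_on_block_subset[OF A'])
      moreover have "{l<..l + i} \<subseteq> insert (Suc l) {Suc l<..<m}" using m by auto
      ultimately show ?thesis using U(2) by blast
    next
      assume "U \<in> B"
      then have "U \<subseteq> {m<..m + j}" by (rule partition_on_block_subset[OF B'])
      then show ?thesis by auto
    qed
    then show ?thesis using same_gapI[of "Suc l" m U] U False m by simp
  qed
  then show ?thesis using partition_on_merge[OF g(1) xy] non_crossing_merge[OF g xy] by simp
qed

lemma NC_on_low_join: "low_join t l \<in> NC_on {l<..l + size t}"
proof (induction t arbitrary: l)
  case Leaf
  then show ?case by (simp add: partition_on_empty non_crossing_def)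
next
  case (Node a b)
  then show ?case
    using NC_on_merge_glue[OF Node.IH(1)[of l] Node.IH(2) refl] by (simp add: Let_def add.assoc)
qed

lemma partition_on_low_join: "partition_on {l<..l + size t} (low_join t l)"
  using NC_on_low_join by blast

text \<open>Only the block of \<open>Suc l\<close> grows, by the root \<open>m\<close>. If
  \<open>i = 0\<close>, then \<open>A\<close> is empty, the union is empty and the root stays a
  singleton.\<close>

lemma merge_glue_eq:
  assumes A: "partition_on {l<..l + i} A" and B: "partition_on {m<..m + j} B" and m: "m = Suc (l + i)"
  shows "merge (Suc l) m (glue m A B)
    = insert (insert m (\<Union>{X\<in>A. Suc l \<in> X})) ({X\<in>A. Suc l \<notin> X} \<union> B)"
proof -
  have A': "m \<notin> X" if "X \<in> A" for X using partition_on_block_subset[OF A that] m by auto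
  have B': "m \<notin> X" "Suc l \<notin> X" if "X \<in> B" for X
    using partition_on_block_subset[OF B that] m by auto
  have "{X \<in> glue m A B. Suc l \<in> X \<or> m \<in> X} = insert {m} {X\<in>A. Suc l \<in> X}"
    "{X \<in> glue m A B. Suc l \<notin> X \<and> m \<notin> X} = {X\<in>A. Suc l \<notin> X} \<union> B"
    unfolding glue_def using A' B' by auto
  then show ?thesis unfolding merge_def by simp
qed

text \<open>The decoding step: the root is the largest point in the block of the lowest point, and
  cutting there recovers both parts.\<close>

lemma restrict_merge_glue:
  assumes A: "partition_on {l<..l + i} A" and B: "partition_on {m<..m + j} B" and m: "m = Suc (l + i)"
  defines "P \<equiv> merge (Suc l) m (glue m A B)"
  shows "(\<inter>) {..<m} ` P - {{}} = A" "(\<inter>) {m<..} ` P - {{}} = B"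
    "Max (\<Union>{X\<in>P. Suc l \<in> X}) = m"
proof -
  define V where "V = \<Union>{X\<in>A. Suc l \<in> X}"
  have P: "P = insert (insert m V) ({X\<in>A. Suc l \<notin> X} \<union> B)"
    unfolding P_def V_def by (rule merge_glue_eq[OF A B m])
  have Asub: "X \<subseteq> {l<..<m}" if "X \<in> A" for X using partition_on_block_subset[OF A that] m by auto
  have Bsub: "X \<subseteq> {m<..}" if "X \<in> B" for X using partition_on_block_subset[OF B that] by auto
  have ne: "{} \<notin> A" "{} \<notin> B" using A B by (auto simp: partition_on_def)
  have V: "V \<subseteq> {l<..<m}" using Asub unfolding V_def by blast
  \<comment> \<open>Removing the empty set treats both cases at once: \<open>V\<close> is the block
    of \<open>Suc l\<close> in \<open>A\<close>, or empty when there is none.\<close>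
  have VA: "{V} - {{}} = {X\<in>A. Suc l \<in> X}"
  proof (cases "\<exists>X\<in>A. Suc l \<in> X")
    case True
    then obtain X where X: "X \<in> A" "Suc l \<in> X" by blast
    then have "{X\<in>A. Suc l \<in> X} = {X}" using partition_on_block_eq[OF A] by blast
    then show ?thesis using X unfolding V_def by auto
  next
    case False
    then have "{X\<in>A. Suc l \<in> X} = {}" by blast
    then show ?thesis unfolding V_def by (simp only: Union_empty Diff_cancel)
  qed
  have cut: "{..<m} \<inter> insert m V = V" "{m<..} \<inter> insert m V = {}" using V by auto
  have cutA: "{..<m} \<inter> X = X" "{m<..} \<inter> X = {}" if "X \<in> A" for X using Asub[OF that] by auto
  have cutB: "{..<m} \<inter> X = {}" "{m<..} \<inter> X = X" if "X \<in> B" for X using Bsub[OF that] by auto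
  have imA: "(\<inter>) {..<m} ` {X\<in>A. Suc l \<notin> X} = {X\<in>A. Suc l \<notin> X}" using cutA(1) by force
  have imB: "(\<inter>) {..<m} ` B \<subseteq> {{}}" using cutB(1) by blast
  have "(\<inter>) {..<m} ` P - {{}} = ({V} - {{}}) \<union> ({X\<in>A. Suc l \<notin> X} - {{}})"
    unfolding P image_insert image_Un cut imA using imB by blast
  then show "(\<inter>) {..<m} ` P - {{}} = A" unfolding VA using ne by blast
  have imA: "(\<inter>) {m<..} ` {X\<in>A. Suc l \<notin> X} \<subseteq> {{}}" using cutA(2) by blast
  have imB: "(\<inter>) {m<..} ` B = B" using cutB(2) by force
  show "(\<inter>) {m<..} ` P - {{}} = B"
    unfolding P image_insert image_Un cut imB using imA ne by blast
  have "Suc l \<in> insert m V"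
  proof (cases i)
    case (Suc k)
    then have "Suc l \<in> \<Union>A" using partition_onD1[OF A] by auto
    then show ?thesis unfolding V_def by blast
  qed (simp add: m)
  moreover have "Suc l \<notin> X" if "X \<in> B" for X using Bsub[OF that] m by auto
  ultimately have "{X\<in>P. Suc l \<in> X} = {insert m V}" unfolding P by blast
  moreover have "Max (insert m V) = m"
    using V by (intro Max_eqI finite_subset[of "insert m V" "{..m}"]) auto
  ultimately show "Max (\<Union>{X\<in>P. Suc l \<in> X}) = m" by simp
qed

lemma low_join_inject: "low_join s l = low_join t l \<longleftrightarrow> s = t"
proof
  assume "low_join s l = low_join t l"
  then show "s = t"
  proof (induction s arbitrary: t l)
    case Leaf
    have "{l<..l + size t} = {}"
      using partition_onD1[OF partition_on_low_join[of l t]] Leaf by auto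
    then show ?case by (cases t) auto
  next
    case (Node a b)
    have "low_join t l \<noteq> {}"
      using partition_onD1[OF partition_on_low_join[of l "Node a b"]] Node.prems by auto
    then obtain a' b' where t: "t = Node a' b'" by (cases t) auto
    define m where "m = Suc (l + size a)"
    define m' where "m' = Suc (l + size a')"
    have eq: "merge (Suc l) m (glue m (low_join a l) (low_join b m))
        = merge (Suc l) m' (glue m' (low_join a' l) (low_join b' m'))"
      using Node.prems unfolding t m_def m'_def by (simp add: Let_def)
    note r = restrict_merge_glue[OF partition_on_low_join partition_on_low_join m_def, of b]
    note r' = restrict_merge_glue[OF partition_on_low_join partition_on_low_join m'_def, of b']
    have "m = m'" using r(3) r'(3) eq by simp
    then have "low_join a l = low_join a' l" "low_join b m = low_join b' m"
      using r(1,2) r'(1,2) eq by simp_all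
    then show ?case using Node.IH t by simp
  qed
qed simp

text \<open>Inverts the root step of \<open>low_join\<close>: cut at the largest point of the block
  containing the lowest point.\<close>

lemma NC_on_decompose:
  assumes P: "P \<in> NC_on {l<..l + Suc n}"
  obtains i j A B where "n = i + j" "A \<in> NC_on {l<..l + i}"
    "B \<in> NC_on {Suc (l + i)<..Suc (l + i) + j}"
    "P = merge (Suc l) (Suc (l + i)) (glue (Suc (l + i)) A B)"
proof -
  have p: "partition_on {l<..l + Suc n} P" "non_crossing P" using P by auto
  obtain X0 where X0: "X0 \<in> P" "Suc l \<in> X0" using partition_on_obtain_block[OF p(1), of "Suc l"] by auto
  have sub: "X \<subseteq> {l<..l + Suc n}" if "X \<in> P" for X using partition_on_block_subset[OF p(1) that] .
  have fin: "finite X0" using sub[OF X0(1)] finite_subset by blast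
  define m where "m = Max X0"
  have mX: "m \<in> X0" using Max_in[OF fin] X0 unfolding m_def by blast
  have X0m: "X0 \<subseteq> {..m}" using Max_ge[OF fin] unfolding m_def by blast
  have lm: "l < m" "m \<le> l + Suc n" using sub[OF X0(1)] mX by auto
  define i where "i = m - Suc l"
  define j where "j = n - i"
  have m: "m = Suc (l + i)" and n: "n = i + j" using lm unfolding i_def j_def by auto
  \<comment> \<open>A block on both sides of \<open>m\<close> would cross \<open>X0\<close>, which
    contains both the lowest point \<open>Suc l\<close> and \<open>m\<close>.\<close>
  have side: "X \<subseteq> {..<m} \<or> X \<subseteq> {m<..}" if X: "X \<in> P" "X \<noteq> X0" for X
  proof (rule ccontr)
    assume "\<not> (X \<subseteq> {..<m} \<or> X \<subseteq> {m<..})"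
    then obtain a b where ab: "a \<in> X" "b \<in> X" "\<not> a < m" "\<not> m < b" by auto
    have notin: "m \<notin> X" "Suc l \<notin> X" using X X0 mX partition_on_block_eq[OF p(1)] by blast+
    have "m < a" "b < m" using ab notin by (metis linorder_neqE_nat)+
    moreover have "Suc l < b" using sub[OF X(1)] ab(2) notin(2)
      by (metis Suc_lessI greaterThanAtMost_iff subsetD)
    ultimately have "X0 = X" using non_crossingD[OF p(2) X0(1) X(1) _ _ _ X0(2) ab(2) mX ab(1)] by blast
    then show False using X(2) by simp
  qed
  define A where "A = (\<inter>) {..<m} ` P - {{}}"
  define B where "B = (\<inter>) {m<..} ` P - {{}}"
  have "{..<m} \<inter> {l<..l + Suc n} = {l<..l + i}" using m n by auto
  then have A: "A \<in> NC_on {l<..l + i}" using NC_on_restrict[OF P, of "{..<m}"] unfolding A_def by simp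
  have "{m<..} \<inter> {l<..l + Suc n} = {m<..m + j}" using m n by auto
  then have B: "B \<in> NC_on {m<..m + j}" using NC_on_restrict[OF P, of "{m<..}"] unfolding B_def by simp
  have pA: "partition_on {l<..l + i} A" and pB: "partition_on {m<..m + j} B" using A B by auto
  have ne: "{} \<notin> P" using p(1) by (rule partition_onD3)
  have cut: "{m<..} \<inter> X0 = {}" "insert m ({..<m} \<inter> X0) = X0" using X0m mX by auto
  have cutA: "{..<m} \<inter> X = X" "{m<..} \<inter> X = {}" if "X \<subseteq> {..<m}" for X using that by auto
  have cutB: "{..<m} \<inter> X = {}" "{m<..} \<inter> X = X" if "X \<subseteq> {m<..}" for X using that by auto
  have other: "Suc l \<notin> X" if "X \<in> P" "X \<noteq> X0" for X
    using that X0 partition_on_block_eq[OF p(1)] by blast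
  \<comment> \<open>The block of \<open>Suc l\<close> in \<open>A\<close> is \<open>X0\<close>
    without \<open>m\<close>; when \<open>m\<close> is itself the lowest point, both sides are
    empty.\<close>
  have A1: "\<Union>{X\<in>A. Suc l \<in> X} = {..<m} \<inter> X0"
  proof (cases "m = Suc l")
    case True
    then have "A = {}" using pA m by (simp add: partition_on_empty)
    moreover have "{..<m} \<inter> X0 = {}" using sub[OF X0(1)] True by auto
    ultimately show ?thesis by simp
  next
    case False
    then have "Suc l \<in> {..<m} \<inter> X0" using X0 m by auto
    moreover then have "{..<m} \<inter> X0 \<in> A" unfolding A_def using X0 by blast
    ultimately have "{X\<in>A. Suc l \<in> X} = {{..<m} \<inter> X0}" using partition_on_block_eq[OF pA] by blast
    then show ?thesis by simp
  qed
  have A2: "{X\<in>A. Suc l \<notin> X} = {X\<in>P. X \<noteq> X0 \<and> X \<subseteq> {..<m}}"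
  proof (intro equalityI subsetI)
    fix Y assume "Y \<in> {X\<in>A. Suc l \<notin> X}"
    then obtain X where X: "X \<in> P" "Y = {..<m} \<inter> X" "Y \<noteq> {}" "Suc l \<notin> Y" unfolding A_def by blast
    have nX0: "X \<noteq> X0"
    proof
      assume "X = X0"
      then have "\<not> Suc l < m" using X X0 by auto
      then have "m = Suc l" using m by simp
      then show False using X sub[OF X(1)] by auto
    qed
    then have "Y = X" using side[OF X(1)] X(2,3) cutA(1) cutB(1) by blast
    then show "Y \<in> {X\<in>P. X \<noteq> X0 \<and> X \<subseteq> {..<m}}" using X nX0 by blast
  next
    fix X assume "X \<in> {X\<in>P. X \<noteq> X0 \<and> X \<subseteq> {..<m}}"
    then have X: "X \<in> P" "X \<noteq> X0" "{..<m} \<inter> X = X" using cutA(1) by auto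
    then have "X \<in> A" unfolding A_def using ne by (metis DiffI image_eqI singletonD)
    then show "X \<in> {X\<in>A. Suc l \<notin> X}" using other X by simp
  qed
  have B1: "B = {X\<in>P. X \<subseteq> {m<..}}"
  proof (intro equalityI subsetI)
    fix Y assume "Y \<in> B"
    then obtain X where X: "X \<in> P" "Y = {m<..} \<inter> X" "Y \<noteq> {}" unfolding B_def by blast
    then have "X \<noteq> X0" using cut by blast
    then have "Y = X" using side[OF X(1)] X(2,3) cutA(2) cutB(2) by blast
    then show "Y \<in> {X\<in>P. X \<subseteq> {m<..}}" using X by blast
  next
    fix X assume "X \<in> {X\<in>P. X \<subseteq> {m<..}}"
    then have X: "X \<in> P" "{m<..} \<inter> X = X" using cutB(2) by auto
    then show "X \<in> B" unfolding B_def using ne by (metis DiffI image_eqI singletonD)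
  qed
  have "P = insert X0 ({X\<in>P. X \<noteq> X0 \<and> X \<subseteq> {..<m}} \<union> {X\<in>P. X \<subseteq> {m<..}})"
    using side X0(1) by blast
  also have "\<dots> = merge (Suc l) m (glue m A B)"
    by (simp only: merge_glue_eq[OF pA pB m] A1 A2 cut B1[symmetric])
  finally show thesis using that[OF n A, of B] B unfolding m by blast
qed

lemma low_join_surj:
  assumes "P \<in> NC_on {l<..l + n}"
  shows "\<exists>t. size t = n \<and> low_join t l = P"
  using assms
proof (induction n arbitrary: l P rule: less_induct)
  case (less n)
  show ?case
  proof (cases n)
    case 0
    then have "P = {}" using less.prems by (simp add: partition_on_empty)
    then show ?thesis using 0 by (intro exI[of _ Leaf]) simp
  next
    case (Suc k)
    obtain i j A B where d: "k = i + j" "A \<in> NC_on {l<..l + i}"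
      "B \<in> NC_on {Suc (l + i)<..Suc (l + i) + j}"
      "P = merge (Suc l) (Suc (l + i)) (glue (Suc (l + i)) A B)"
      by (rule NC_on_decompose[OF less.prems[unfolded Suc]])
    obtain a where a: "size a = i" "low_join a l = A" using less.IH[OF _ d(2)] d(1) Suc by auto
    obtain b where b: "size b = j" "low_join b (Suc (l + i)) = B"
      using less.IH[OF _ d(3)] d(1) Suc by auto
    show ?thesis using a b d Suc by (intro exI[of _ "Node a b"]) (simp add: Let_def)
  qed
qed

lemma bij_betw_low_join: "bij_betw (\<lambda>t. low_join t 0) {t. size t = n} (NC n)"
proof -
  have "{0<..n} = {1..n}" by auto
  then have NC: "NC n = NC_on {0<..0 + n}" by (simp add: NC_def)
  show ?thesis unfolding bij_betw_def
  proof
    show "inj_on (\<lambda>t. low_join t 0) {t. size t = n}" by (simp add: inj_on_def low_join_inject)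
    show "(\<lambda>t. low_join t 0) ` {t. size t = n} = NC n"
      using NC_on_low_join[of _ 0] low_join_surj[of _ 0 n] unfolding NC by force
  qed
qed

section \<open>The second encoding as a reflection of the first\<close>

lemma merge_commute: "merge x y P = merge y x P"
  unfolding merge_def by (simp add: disj_commute conj_commute)

lemma glue_image:
  assumes "f m = m'"
  shows "(`) ((`) f) (glue m A B) = glue m' ((`) f ` B) ((`) f ` A)"
  unfolding glue_def using assms by auto

lemma partition_on_glue_low_join:
  "partition_on {l<..Suc (l + size a) + size b}
     (glue (Suc (l + size a)) (low_join a l) (low_join b (Suc (l + size a))))"
  using NC_on_glue[OF NC_on_low_join NC_on_low_join] by blast

text \<open>Reflection exchanges lowest and highest points, mirroring exchanges the children. Two
  independent offsets are kept because each subtree starts elsewhere in the mirrored tree; their sum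
  adjusts so that \<open>s\<close> is the same at every node.\<close>

lemma high_join_eq_reflect:
  assumes "s = Suc (l + l' + size t)"
  shows "high_join t l = (`) (\<lambda>i. s - i) ` low_join (mirror t) l'"
  using assms
proof (induction t arbitrary: l l')
  case (Node a b)
  define f where "f i = s - i" for i
  define m where "m = Suc (l + size a)"
  define m' where "m' = Suc (l' + size b)"
  have s: "s = m + m'" "m + size b = f (Suc l')" "f m' = m"
    using Node.prems unfolding m_def m'_def f_def by simp_all
  have a: "high_join a l = (`) f ` low_join (mirror a) m'"
    unfolding f_def by (rule Node.IH(1)) (simp add: s m_def)
  have b: "high_join b m = (`) f ` low_join (mirror b) l'"
    unfolding f_def by (rule Node.IH(2)) (simp add: s m'_def)
  define Q where "Q = glue m' (low_join (mirror b) l') (low_join (mirror a) m')"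
  have Q: "\<Union>Q = {l'<..m' + size a}"
    using partition_onD1[OF partition_on_glue_low_join[of l' "mirror b" "mirror a"]]
    unfolding Q_def m'_def by simp
  have inj: "inj_on f (\<Union>Q)"
    unfolding Q using Node.prems by (auto simp: inj_on_def f_def m'_def)
  have "high_join (Node a b) l = merge (f m') (f (Suc l')) ((`) f ` Q)"
    using a b s glue_image[of f m' m] unfolding Q_def by (simp add: Let_def m_def)
  also have "\<dots> = (`) f ` merge m' (Suc l') Q"
    by (rule merge_image[OF inj]) (auto simp: Q m'_def)
  also have "merge m' (Suc l') Q = low_join (mirror (Node a b)) l'"
    by (simp add: Q_def m'_def Let_def merge_commute)
  finally show ?case by (simp add: f_def)
qed simp

text \<open>By reflection, the map is a composition of three bijections: mirroring trees,
  \<open>low_join\<close>, and reversing \<open>{1..n}\<close>.\<close>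

lemma bij_betw_high_join: "bij_betw (\<lambda>t. high_join t 0) {t. size t = n} (NC n)"
proof -
  define f where "f i = Suc n - i" for i
  define \<rho> where "\<rho> = (\<lambda>P. (`) f ` P)"
  have NC: "NC n = NC_on {1..n}" by (simp add: NC_def)
  have img: "f ` {1..n} = {1..n}"
  proof (intro equalityI subsetI)
    fix x assume "x \<in> {1..n}"
    then have "x = f (f x)" "f x \<in> {1..n}" unfolding f_def by auto
    then show "x \<in> f ` {1..n}" by blast
  qed (auto simp: f_def)
  have anti: "f x < f y \<longleftrightarrow> y < x" if "x \<in> {1..n}" "y \<in> {1..n}" for x y
    using that by (auto simp: f_def)
  have "\<rho> P \<in> NC n" if "P \<in> NC n" for P
    using NC_on_image_antimono[OF that[unfolded NC] anti] unfolding img NC \<rho>_def .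
  then have into: "\<rho> ` NC n \<subseteq> NC n" by blast
  have "\<rho> (\<rho> P) = P" if "P \<in> NC n" for P
  proof -
    have "f ` f ` X = X" if "X \<in> P" for X
    proof -
      have "X \<subseteq> {1..n}" using partition_on_block_subset NC_D(1)[OF \<open>P \<in> NC n\<close>] that by blast
      then have "f (f x) = x" if "x \<in> X" for x using that by (auto simp: f_def)
      then show ?thesis by (simp add: image_image)
    qed
    then show ?thesis unfolding \<rho>_def by (simp add: image_image)
  qed
  then have rho: "bij_betw \<rho> (NC n) (NC n)" using into by (intro bij_betwI[of _ _ _ \<rho>]) auto
  have mirror: "bij_betw mirror {t. size t = n} {t. size t = n}"
    by (intro bij_betwI[of _ _ _ mirror]) auto
  have bij: "bij_betw (\<rho> \<circ> ((\<lambda>t. low_join t 0) \<circ> mirror)) {t. size t = n} (NC n)"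
    by (rule bij_betw_trans[OF bij_betw_trans[OF mirror bij_betw_low_join] rho])
  have eq: "(\<rho> \<circ> ((\<lambda>t. low_join t 0) \<circ> mirror)) t = high_join t 0" if "size t = n" for t
    using high_join_eq_reflect[of "Suc n" 0 0 t] that unfolding \<rho>_def f_def by simp
  show ?thesis using bij by (rule iffD1[OF bij_betw_cong, rotated]) (simp only: eq mem_Collect_eq)
qed

lemma NC_on_high_join: "high_join t l \<in> NC_on {l<..l + size t}"
proof -
  define s where "s = Suc (l + 0 + size t)"
  define f where "f i = s - i" for i
  have "(`) f ` low_join (mirror t) 0 \<in> NC_on (f ` {0<..0 + size (mirror t)})"
    by (rule NC_on_image_antimono[OF NC_on_low_join]) (auto simp: f_def s_def)
  moreover have "f ` {0<..0 + size (mirror t)} = {l<..l + size t}"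
  proof (intro equalityI subsetI)
    fix x assume "x \<in> {l<..l + size t}"
    then have "x = f (f x)" "f x \<in> {0<..0 + size (mirror t)}" unfolding f_def s_def by auto
    then show "x \<in> f ` {0<..0 + size (mirror t)}" by blast
  qed (auto simp: f_def s_def)
  ultimately show ?thesis
    using high_join_eq_reflect[OF s_def] unfolding f_def by simp
qed

lemma partition_on_glue_high_join:
  "partition_on {l<..Suc (l + size a) + size b}
     (glue (Suc (l + size a)) (high_join a l) (high_join b (Suc (l + size a))))"
  using NC_on_glue[OF NC_on_high_join NC_on_high_join] by blast

section \<open>The two partitions of a tree\<close>

lemma merge_joins:
  assumes "partition_on A P" "x \<in> A" "y \<in> A"
  shows "\<exists>X\<in>merge x y P. x \<in> X \<and> y \<in> X"
proof -
  have "x \<in> \<Union>{X\<in>P. x \<in> X \<or> y \<in> X}" "y \<in> \<Union>{X\<in>P. x \<in> X \<or> y \<in> X}"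
    using assms partition_onD1[OF assms(1)] by blast+
  then show ?thesis unfolding merge_def 
    by (intro bexI[of _ "\<Union>{X\<in>P. x \<in> X \<or> y \<in> X}"] conjI insertI1)
qed

lemma merge_block_superset:
  assumes "partition_on A P" "x \<in> A" "y \<in> A" "X \<in> P"
  shows "\<exists>Y\<in>merge x y P. X \<subseteq> Y"
  using refines_merge[OF assms(1-3)] assms(4) unfolding refines_def by blast

text \<open>\<open>Q\<close> stands for lying in one block of a common coarsening; leaving it
  abstract lets the induction pass to subtrees. The low join links the root to the first point, the
  high join links it to the last, and each nonempty subtree contains one of these.\<close>

lemma joins_connect:
  assumes low: "\<And>X x y. X \<in> low_join t l \<Longrightarrow> x \<in> X \<Longrightarrow> y \<in> X \<Longrightarrow> Q x y"
    and high: "\<And>X x y. X \<in> high_join t l \<Longrightarrow> x \<in> X \<Longrightarrow> y \<in> X \<Longrightarrow> Q x y"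
    and trans: "\<And>x y z. Q x y \<Longrightarrow> Q y z \<Longrightarrow> Q x z"
    and xy: "x \<in> {l<..l + size t}" "y \<in> {l<..l + size t}"
  shows "Q x y"
  using low high xy
proof (induction t arbitrary: l x y)
  case Leaf
  then show ?case by simp
next
  case (Node a b)
  define m where "m = Suc (l + size a)"
  define r where "r = m + size b"
  define L where "L = glue m (low_join a l) (low_join b m)"
  define H where "H = glue m (high_join a l) (high_join b m)"
  have L: "partition_on {l<..r} L" and H: "partition_on {l<..r} H"
    using partition_on_glue_low_join[of l a b] partition_on_glue_high_join[of l a b]
    unfolding L_def H_def m_def r_def by simp_all
  have mem: "Suc l \<in> {l<..r}" "m \<in> {l<..r}" "r \<in> {l<..r}" unfolding m_def r_def by auto
  have eq: "low_join (Node a b) l = merge (Suc l) m L" "high_join (Node a b) l = merge m r H"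
    unfolding L_def H_def m_def r_def by (simp_all add: Let_def)
  \<comment> \<open>Blocks formed before the root is joined only grow, so \<open>Q\<close> holds on
    them and the induction hypotheses apply.\<close>
  have lowQ: "Q u v" if "X \<in> L" "u \<in> X" "v \<in> X" for X u v
    using merge_block_superset[OF L mem(1,2) that(1)] Node.prems(1)[of _ u v] that(2,3)
    unfolding eq by blast
  have highQ: "Q u v" if "X \<in> H" "u \<in> X" "v \<in> X" for X u v
    using merge_block_superset[OF H mem(2,3) that(1)] Node.prems(2)[of _ u v] that(2,3)
    unfolding eq by blast
  have lm: "Q (Suc l) m" "Q m (Suc l)"
    using merge_joins[OF L mem(1,2)] Node.prems(1) unfolding eq by blast+
  have mr: "Q m r" "Q r m"
    using merge_joins[OF H mem(2,3)] Node.prems(2) unfolding eq by blast+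
  have IHa: "Q u v" if "u \<in> {l<..l + size a}" "v \<in> {l<..l + size a}" for u v
  proof (rule Node.IH(1)[OF _ _ that])
    fix X x y assume "X \<in> low_join a l" "x \<in> X" "y \<in> X"
    then show "Q x y" by (intro lowQ[of X]) (simp_all add: L_def glue_def)
  next
    fix X x y assume "X \<in> high_join a l" "x \<in> X" "y \<in> X"
    then show "Q x y" by (intro highQ[of X]) (simp_all add: H_def glue_def)
  qed
  have IHb: "Q u v" if "u \<in> {m<..m + size b}" "v \<in> {m<..m + size b}" for u v
  proof (rule Node.IH(2)[OF _ _ that])
    fix X x y assume "X \<in> low_join b m" "x \<in> X" "y \<in> X"
    then show "Q x y" by (intro lowQ[of X]) (simp_all add: L_def glue_def)
  next
    fix X x y assume "X \<in> high_join b m" "x \<in> X" "y \<in> X"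
    then show "Q x y" by (intro highQ[of X]) (simp_all add: H_def glue_def)
  qed
  have centre: "Q u m \<and> Q m u" if u: "u \<in> {l<..l + size (Node a b)}" for u
  proof -
    consider "u \<in> {l<..l + size a}" | "u = m" | "u \<in> {m<..m + size b}"
      using u unfolding m_def by force
    then show ?thesis
    proof cases
      case 1
      then have "Suc l \<in> {l<..l + size a}" by auto
      then show ?thesis using IHa 1 lm trans by blast
    next
      case 2
      then show ?thesis using lm trans by blast
    next
      case 3
      then have "r \<in> {m<..m + size b}" unfolding r_def by auto
      then show ?thesis using IHb 3 mr trans by blast
    qed
  qed
  show ?case using centre Node.prems(3,4) trans by blast
qed

text \<open>The root contributes a new singleton. Merging loses at most one block, and none if the
  root is joined to itself.\<close>

lemma card_merge_glue_ge:
  assumes A: "partition_on {l<..l + i} A" and B: "partition_on {m<..m + j} B" and m: "m = Suc (l + i)"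
    and g: "partition_on {l<..m + j} (glue m A B)" and xy: "x \<in> {l<..m + j}" "y \<in> {l<..m + j}"
  shows "card A + card B + (if x = y then 1 else 0) \<le> card (merge x y (glue m A B))"
proof -
  have fin: "finite A" "finite B" using A B finite_elements by auto
  have "m \<notin> X" if "X \<in> A" for X using partition_on_block_subset[OF A that] m by auto
  moreover have Bm: "X \<subseteq> {m<..}" if "X \<in> B" for X using partition_on_block_subset[OF B that] by auto
  moreover have "A \<inter> B = {}"
  proof (rule ccontr)
    assume "A \<inter> B \<noteq> {}"
    then obtain X where X: "X \<in> A" "X \<in> B" by blast
    then have "X \<subseteq> {..m}" "X \<subseteq> {m<..}"
      using partition_on_block_subset[OF A X(1)] Bm m by auto
    then have "X = {}" by fastforce
    then show False using partition_onD3[OF A] X by simp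
  qed
  ultimately have "card (glue m A B) = card A + Suc (card B)"
    unfolding glue_def using fin by (subst card_Un_disjoint) (auto simp: card_insert_if)
  moreover have "merge x y (glue m A B) = glue m A B" if "x = y"
    using that merge_same_block[OF g] partition_on_obtain_block[OF g xy(1)] by metis
  moreover have "finite (glue m A B)" unfolding glue_def using fin by simp
  ultimately show ?thesis using card_merge_ge[OF g _ xy] by auto
qed

text \<open>Behind this is the count of leaves: a tree with \<open>n\<close> nodes has
  \<open>n + 1\<close> leaves, and each leaf child saves one block in one of the two
  partitions.\<close>

lemma card_joins_ge:
  "t \<noteq> Leaf \<Longrightarrow> Suc (size t) \<le> card (low_join t l) + card (high_join t l)"
proof (induction t arbitrary: l)
  case (Node a b)
  define m where "m = Suc (l + size a)"
  have mem: "Suc l \<in> {l<..m + size b}" "m \<in> {l<..m + size b}" "m + size b \<in> {l<..m + size b}"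
    unfolding m_def by auto
  have l0: "Suc l = m \<longleftrightarrow> a = Leaf" "m = m + size b \<longleftrightarrow> b = Leaf"
    unfolding m_def by (simp_all add: size_eq_0_iff_Leaf)
  have "card (low_join a l) + card (low_join b m) + (if a = Leaf then 1 else 0)
      \<le> card (low_join (Node a b) l)"
    using card_merge_glue_ge[OF partition_on_low_join[of l a] partition_on_low_join[of m b] m_def
        partition_on_glue_low_join[of l a b, folded m_def] mem(1,2)] l0(1)
    by (simp add: Let_def m_def)
  moreover have "card (high_join a l) + card (high_join b m) + (if b = Leaf then 1 else 0)
      \<le> card (high_join (Node a b) l)"
  proof -
    have p: "partition_on {l<..l + size a} (high_join a l)" "partition_on {m<..m + size b} (high_join b m)"
      using NC_on_high_join by blast+
    show ?thesis
      using card_merge_glue_ge[OF p m_def partition_on_glue_high_join[of l a b, folded m_def] mem(2,3)] l0(2)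
      by (simp add: Let_def m_def)
  qed
  \<comment> \<open>A leaf child has no blocks but gains 1 from the conditional term; an inner child
    gives its size plus 1 by induction. Either way each child contributes its size plus 1.\<close>
  ultimately show ?case using Node.IH(1)[of l] Node.IH(2)[of m]
    by (cases a; cases b) auto
qed simp

lemma d_H_joins_ge:
  assumes "n \<ge> 1" "size t = n"
  shows "real n - 1 \<le> d_H n (low_join t 0) (high_join t 0)"
proof -
  have NC: "low_join t 0 \<in> NC n" "high_join t 0 \<in> NC n"
    using bij_betw_apply[OF bij_betw_low_join, of t n] bij_betw_apply[OF bij_betw_high_join, of t n]
      assms(2) by simp_all
  have "card T \<le> 1" if T: "refines {1..n} (low_join t 0) T" "refines {1..n} (high_join t 0) T" for T
  proof -
    have pT: "partition_on {1..n} T" using T by (simp add: refines_def)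
    define Q where "Q x y \<longleftrightarrow> (\<exists>Y\<in>T. x \<in> Y \<and> y \<in> Y)" for x y
    have Q: "Q x y" if xy: "x \<in> {1..n}" "y \<in> {1..n}" for x y
    proof (rule joins_connect[of t 0 Q])
      show "Q x y" if "X \<in> low_join t 0" "x \<in> X" "y \<in> X" for X x y
        using T(1) that unfolding refines_def Q_def by blast
      show "Q x y" if "X \<in> high_join t 0" "x \<in> X" "y \<in> X" for X x y
        using T(2) that unfolding refines_def Q_def by blast
      show "Q x z" if "Q x y" "Q y z" for x y z
        using that partition_on_block_eq[OF pT] unfolding Q_def by blast
      show "x \<in> {0<..0 + size t}" "y \<in> {0<..0 + size t}" using xy assms(2) by auto
    qed
    have "X = Y" if XY: "X \<in> T" "Y \<in> T" for X Y
    proof -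
      obtain x y where xy: "x \<in> X" "y \<in> Y" using XY partition_onD3[OF pT] by (metis ex_in_conv)
      then have "Q x y" using Q partition_on_block_subset[OF pT] XY by blast
      then show ?thesis using partition_on_block_eq[OF pT] XY xy unfolding Q_def by metis
    qed
    \<comment> \<open>Connectedness has made any two blocks equal; an infinite \<open>T\<close>
      would have cardinality 0 by convention.\<close>
    then show ?thesis by (metis One_nat_def card_le_Suc0_iff_eq card.infinite zero_le)
  qed
  then have "real (card (low_join t 0)) + real (card (high_join t 0)) - 2
      \<le> d_H n (low_join t 0) (high_join t 0)" by (rule d_H_ge[OF NC])
  moreover have "t \<noteq> Leaf" using assms by auto
  ultimately show ?thesis using card_joins_ge[of t 0] assms(2) by simp
qed

section \<open>Counting\<close>

unbundle fps_syntax

text \<open>Segner's convolution recurrence, from cutting a tree at its root.\<close>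

lemma card_btree_Suc:
  "card {t::btree. size t = Suc n}
    = (\<Sum>i=0..n. card {t::btree. size t = i} * card {t::btree. size t = n - i})"
proof -
  \<comment> \<open>Finiteness of the set of trees is inherited from \<open>NC k\<close> through the
    bijection.\<close>
  have fin: "finite {t::btree. size t = k}" for k
    using bij_betw_low_join[of k] finite_NC by (simp add: bij_betw_finite)
  have "{t. size t = Suc n}
      = (\<lambda>(i, a, b). Node a b) ` (SIGMA i:{0..n}. {a. size a = i} \<times> {b. size b = n - i})"
  proof (intro equalityI subsetI)
    fix t :: btree assume "t \<in> {t. size t = Suc n}"
    then obtain a b where "t = Node a b" "size a + size b = n" by (cases t) auto
    then show "t \<in> (\<lambda>(i, a, b). Node a b) ` (SIGMA i:{0..n}. {a. size a = i} \<times> {b. size b = n - i})"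
      by (intro image_eqI[of _ _ "(size a, a, b)"]) auto
  qed auto
  moreover have "inj_on (\<lambda>(i, a, b). Node a b)
      (SIGMA i:{0..n}. {a. size a = i} \<times> {b. size b = n - i})"
    by (auto simp: inj_on_def)
  ultimately have "card {t::btree. size t = Suc n}
      = card (SIGMA i:{0..n}. {a::btree. size a = i} \<times> {b::btree. size b = n - i})"
    by (simp only: card_image)
  also have "\<dots> = (\<Sum>i=0..n. card {t::btree. size t = i} * card {t::btree. size t = n - i})"
    using fin by (subst card_SigmaI) (auto simp: card_cartesian_product)
  finally show ?thesis .
qed

text \<open>With \<open>C\<close> the generating function, \<open>C = 1 + X C\<^sup>2\<close> says that \<open>u = 1 - 2 X C\<close> satisfies
  \<open>u\<^sup>2 = 1 - 4 X\<close>; hence \<open>(1 - 4 X) u' = - 2 u\<close>, a first-order recurrence for the coefficients.\<close>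

lemma card_btree_recurrence:
  defines "c \<equiv> \<lambda>n. real (card {t::btree. size t = n})"
  shows "(real n + 2) * c (Suc n) = (4 * real n + 2) * c n"
proof -
  define C where "C = Abs_fps c"
  define u where "u = 1 - 2 * fps_X * C"
  have c0: "c 0 = 1" by (simp add: c_def size_eq_0_iff_Leaf)
  have C: "C = 1 + fps_X * (C * C)"
  proof (rule fps_ext)
    fix k show "C $ k = (1 + fps_X * (C * C)) $ k"
    proof (cases k)
      case (Suc j)
      have "C $ Suc j = (\<Sum>i=0..j. c i * c (j - i))"
        unfolding C_def c_def fps_nth_Abs_fps card_btree_Suc by simp
      also have "\<dots> = (C * C) $ j" by (simp add: fps_mult_nth C_def)
      finally show ?thesis using Suc by simp
    qed (simp add: C_def c0)
  qed
  have "u * u = 1 - 4 * fps_X * C + 4 * fps_X * (fps_X * (C * C))"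
    unfolding u_def by (simp add: algebra_simps)
  also have "fps_X * (C * C) = C - 1" using C by (simp add: algebra_simps)
  finally have uu: "u * u = 1 - 4 * fps_X" by (simp add: algebra_simps)
  have "fps_deriv (u * u) = fps_deriv (1 - 4 * fps_X)" by (simp only: uu)
  then have du: "2 * (u * fps_deriv u) = - 4" by (simp add: algebra_simps)
  \<comment> \<open>Multiplying by \<open>u\<close> makes \<open>u * u\<close> appear, which is the
    polynomial \<open>1 - 4 * fps_X\<close>.\<close>
  have "2 * ((u * u) * fps_deriv u) = u * (2 * (u * fps_deriv u))" by (simp add: algebra_simps)
  also have "\<dots> = - 4 * u" unfolding du by simp
  finally have ode: "2 * ((1 - 4 * fps_X) * fps_deriv u) = - 4 * u" unfolding uu .
  have u_nth: "u $ Suc k = - 2 * c k" for k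
    unfolding u_def by (simp add: C_def mult.assoc numeral_fps_const)
  have "2 * (fps_deriv u + 2 * u) = 2 * (4 * (fps_X * fps_deriv u))"
    using ode by (simp add: algebra_simps)
  then have "fps_deriv u + fps_const 2 * u = fps_const 4 * (fps_X * fps_deriv u)"
    by (simp add: numeral_fps_const)
  \<comment> \<open>The index is \<open>Suc n\<close> because \<open>u\<close> carries the tree
    counts shifted by one place.\<close>
  then have "(fps_deriv u + fps_const 2 * u) $ Suc n = (fps_const 4 * (fps_X * fps_deriv u)) $ Suc n"
    by simp
  then have "real (n + 2) * u $ Suc (Suc n) + 2 * u $ Suc n = 4 * (real (n + 1) * u $ Suc n)"
    by (simp add: algebra_simps)
  then show ?thesis unfolding u_nth by (simp add: algebra_simps)
qed

lemma card_btree: "real (card {t::btree. size t = n}) = Cat n"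
proof (induction n)
  case 0
  show ?case by (simp add: Cat_def size_eq_0_iff_Leaf)
next
  case (Suc n)
  \<comment> \<open>The closed form satisfies the recurrence of the tree counts; it is checked after
    clearing the factorials in the denominators.\<close>
  have "(real n + 2) * Cat (Suc n) = (4 * real n + 2) * Cat n"
  proof -
    define g where "g = (fact n :: real)"
    define F where "F = (fact (2 * n) :: real)"
    have g: "g \<noteq> 0" by (simp add: g_def)
    have fact: "fact (n + 1) = (real n + 1) * g" "fact (Suc n) = (real n + 1) * g"
      "fact (Suc n + 1) = (real n + 2) * ((real n + 1) * g)"
      "fact (2 * Suc n) = (2 * real n + 2) * ((2 * real n + 1) * F)"
      by (simp_all add: g_def F_def algebra_simps)
    have pos: "real n + 1 \<noteq> 0" "real n + 2 \<noteq> 0" by linarith+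
    have A: "Cat n * (g * ((real n + 1) * g)) = F"
      using g pos unfolding Cat_def fact by (simp add: g_def[symmetric] F_def[symmetric])
    have B: "Cat (Suc n) * ((real n + 1) * g * ((real n + 2) * ((real n + 1) * g)))
        = (2 * real n + 2) * ((2 * real n + 1) * F)"
      using g pos unfolding Cat_def fact by simp
    have "((real n + 2) * Cat (Suc n)) * ((real n + 1) * g * ((real n + 1) * g))
        = Cat (Suc n) * ((real n + 1) * g * ((real n + 2) * ((real n + 1) * g)))"
      by (simp only: mult_ac)
    also have "\<dots> = (4 * real n + 2) * (real n + 1) * (Cat n * (g * ((real n + 1) * g)))"
      unfolding A B by (simp add: algebra_simps)
    also have "\<dots> = ((4 * real n + 2) * Cat n) * ((real n + 1) * g * ((real n + 1) * g))"
      by (simp only: mult_ac)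
    finally have "((real n + 2) * Cat (Suc n)) * ((real n + 1) * g * ((real n + 1) * g))
        = ((4 * real n + 2) * Cat n) * ((real n + 1) * g * ((real n + 1) * g))" .
    then show ?thesis using g pos by simp
  qed
  then have "(real n + 2) * real (card {t::btree. size t = Suc n}) = (real n + 2) * Cat (Suc n)"
    using card_btree_recurrence[of n] Suc.IH by simp
  then show ?case by simp
qed

theorem corollary4p8:
  fixes n :: nat
  assumes "n \<ge> 1"
  shows "1 / (Cat n)\<^sup>2 * (\<Sum>P\<in>NC n. \<Sum>R\<in>NC n. d_H n P R) \<ge> (real n - 1) / 2"
proof -
  define T where "T = {t::btree. size t = n}"
  define S where "S = (\<Sum>P\<in>NC n. \<Sum>R\<in>NC n. d_H n P R)"
  have low: "bij_betw (\<lambda>t. low_join t 0) T (NC n)" and high: "bij_betw (\<lambda>t. high_join t 0) T (NC n)"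
    unfolding T_def by (rule bij_betw_low_join bij_betw_high_join)+
  have cardT: "real (card T) = Cat n" unfolding T_def by (rule card_btree)
  have cardNC: "real (card (NC n)) = Cat n" using bij_betw_same_card[OF low] cardT by simp
  \<comment> \<open>Trees index the pairs \<open>\<pi>\<close>, \<open>K \<pi>\<close>: the first is
    the low join, the second the high join.\<close>
  have "(Cat n)\<^sup>2 * (real n - 1) = (\<Sum>t\<in>T. \<Sum>R\<in>NC n. real n - 1)"
    using cardT cardNC by (simp add: power2_eq_square)
  also have "\<dots> \<le> (\<Sum>t\<in>T. \<Sum>R\<in>NC n. d_H n (low_join t 0) R + d_H n R (high_join t 0))"
  proof (intro sum_mono)
    fix t R assume t: "t \<in> T" and R: "R \<in> NC n"
    have "low_join t 0 \<in> NC n" "high_join t 0 \<in> NC n"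
      using t bij_betw_apply[OF low] bij_betw_apply[OF high] by simp_all
    then have "d_H n (low_join t 0) (high_join t 0)
        \<le> d_H n (low_join t 0) R + d_H n R (high_join t 0)" using R by (intro d_H_triangle)
    then show "real n - 1 \<le> d_H n (low_join t 0) R + d_H n R (high_join t 0)"
      using d_H_joins_ge[OF assms, of t] t by (simp add: T_def)
  qed
  also have "\<dots> = (\<Sum>t\<in>T. \<Sum>R\<in>NC n. d_H n (low_join t 0) R)
      + (\<Sum>t\<in>T. \<Sum>R\<in>NC n. d_H n R (high_join t 0))" by (simp add: sum.distrib)
  also have "(\<Sum>t\<in>T. \<Sum>R\<in>NC n. d_H n (low_join t 0) R) = S"
    unfolding S_def by (rule sum.reindex_bij_betw[OF low])
  also have "(\<Sum>t\<in>T. \<Sum>R\<in>NC n. d_H n R (high_join t 0)) = (\<Sum>Q\<in>NC n. \<Sum>R\<in>NC n. d_H n R Q)"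
    by (rule sum.reindex_bij_betw[OF high])
  \<comment> \<open>Exchanging the two summations puts the arguments of \<open>d_H\<close> back in
    the order used in \<open>S\<close>.\<close>
  also have "\<dots> = S" unfolding S_def by (rule sum.swap)
  finally have "(Cat n)\<^sup>2 * (real n - 1) \<le> 2 * S" by simp
  moreover have "(Cat n)\<^sup>2 > 0" by (simp add: Cat_def)
  ultimately show ?thesis unfolding S_def[symmetric] by (simp add: field_simps)
qed

end
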